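(* Let $\Bbbk$ be an algebraically closed field of characteristic $p>0$, $G$ a linear algebraic group over $\Bbbk$, $V$ a $G$-module and $H$ a subgroup of $G$. Then $\delta(G,V)\ge \epsilon(H,V)$ if $V^G\setminus\mathcal{N}_{G,V}\ne\emptyset$, and $\sigma(G,V)\ge\tau(H,V)$ if $V\setminus\mathcal{N}_{G,V}\neq\emptyset$.
   Context: A $G$-module is a finite-dimensional rational representation $V$ of $G$ over $\Bbbk$. $\Bbbk[V]\cong S(V^* )$ is the ring of polynomial functions on $V$, with $G$-action $(g\cdot f)(v)=f(g^{-1}v)$ and invariant ring $\Bbbk[V]^G$, graded by degree; $\Bbbk[V]^G_d$ is the set of homogeneous invariants of degree $d$ together with $0$, and $\Bbbk[V]^G_{\le d}$ the set of invariants of degree at most $d$. For $S\subseteq \Bbbk[V]$, $S_+$ is the set of elements of $S$ with constant term zero. The nullcone $\mathcal{N}_{G,V}\subseteq V$ is the common zero set of $\Bbbk[V]^G_+$. The same notation is used with a subgroup $H$ in place of $G$. A subset $S\subseteq\Bbbk[V]^G$ is a $\delta$-set (resp. $\sigma$-set) if for every $v\in V^G\setminus\mathcal{N}_{G,V}$ (resp. $v\in V\setminus\mathcal{N}_{G,V}$) there is $f\in S_+$ with $f(v)\neq 0$. Then $\delta(G,V)$ (resp. $\sigma(G,V)$) is the minimal $d\ge0$ such that $\Bbbk[V]^G_{\le d}$ is a $\delta$-set (resp. $\sigma$-set). For a group $H$ acting on $V$ and $v\in V$, put $\epsilon(H,v)=\inf\{d\in\mathbb{N}_{>0} : \text{there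 exists } f\in\Bbbk[V]^H_d \text{ with } f(v)\ne0\}$, where the infimum of the empty set is $\infty$. Put $\epsilon(H,V)=\inf\{\epsilon(H,v): v\in V^H\setminus\mathcal{N}_{H,V}\}$ and $\tau(H,V)=\inf\{\epsilon(H,v): v\in V\setminus\mathcal{N}_{H,V}\}$. *)

theory Defs
  imports
    "HOL-Library.Extended_Nat"
    "HOL-Computational_Algebra.Polynomial"
    "HOL-Algebra.Group"
    "Jordan_Normal_Form.Determinant"
begin

section \<open>Linear algebraic groups\<close>

inductive_set generated_algebra :: "('a \<Rightarrow> 'k::comm_ring_1) set \<Rightarrow> ('a \<Rightarrow> 'k) set"
  for X :: "('a \<Rightarrow> 'k) set" where
  const: "(\<lambda>_. c) \<in> generated_algebra X"
| gen: "f \<in> X \<Longrightarrow> f \<in> generated_algebra X"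
| add: "f \<in> generated_algebra X \<Longrightarrow> g \<in> generated_algebra X \<Longrightarrow> (\<lambda>x. f x + g x) \<in> generated_algebra X"
| mult: "f \<in> generated_algebra X \<Longrightarrow> g \<in> generated_algebra X \<Longrightarrow> (\<lambda>x. f x * g x) \<in> generated_algebra X"

definition GL :: "nat \<Rightarrow> 'k::field mat monoid" where
  "GL n = units_of (ring_mat TYPE('k) n ())"

definition entry_polys :: "nat \<Rightarrow> ('k::field mat \<Rightarrow> 'k) set" where
  "entry_polys n = generated_algebra {\<lambda>A. A $$ (i, j) | i j. i < n \<and> j < n}"

definition zariski_closed_in_GL :: "nat \<Rightarrow> 'k::field mat set \<Rightarrow> bool" where
  "zariski_closed_in_GL n Z \<longleftrightarrow>
     (\<exists>P \<subseteq> entry_polys n. Z = {A \<in> carrier (GL n). \<forall>q\<in>P. q A = 0})"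

text \<open>
  A group together with a closed embedding \<open>\<iota>\<close> into some \<open>GL\<^sub>n\<close>. For a closed subgroup of
  \<open>GL\<^sub>n\<close> the embedding is the inclusion. The coordinate ring is the one induced by the
  embedding: restrictions of polynomials in the matrix entries and the inverse of the determinant.
\<close>

locale linear_algebraic_group = group G
  for G :: "('g, 'b) monoid_scheme" (structure) +
  fixes n :: nat and \<iota> :: "'g \<Rightarrow> 'k::field mat"
  assumes embedding: "\<iota> \<in> mon G (GL n)"
    and closed_image: "zariski_closed_in_GL n (\<iota> ` carrier G)"

definition regular_function ::
    "('g, 'b) monoid_scheme \<Rightarrow> nat \<Rightarrow> ('g \<Rightarrow> 'k::field mat) \<Rightarrow> ('g \<Rightarrow> 'k) \<Rightarrow> bool" where
  "regular_function G n \<iota> f \<longleftrightarrow>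
     (\<exists>q \<in> entry_polys n. \<exists>r::nat. \<forall>g \<in> carrier G. f g = q (\<iota> g) / det (\<iota> g) ^ r)"

section \<open>Rational modules\<close>

definition dual_space :: "('k::field \<Rightarrow> 'v::ab_group_add \<Rightarrow> 'v) \<Rightarrow> ('v \<Rightarrow> 'k) set" where
  "dual_space scale = {\<phi>. Vector_Spaces.linear scale (*) \<phi>}"

text \<open>
  The module is the whole type \<open>'v\<close> with scalar multiplication \<open>scale\<close>; the basis \<open>B\<close> only
  witnesses finite dimension. Rationality means that all matrix coefficients are regular.
\<close>

locale rational_module =
  linear_algebraic_group G n \<iota> + finite_dimensional_vector_space scale B
  for G :: "('g, 'b) monoid_scheme" (structure)
    and n :: nat and \<iota> :: "'g \<Rightarrow> 'k::field mat"
    and scale :: "'k \<Rightarrow> 'v::ab_group_add \<Rightarrow> 'v" and B :: "'v set" +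
  fixes \<rho> :: "'g \<Rightarrow> 'v \<Rightarrow> 'v"
  assumes action_linear: "g \<in> carrier G \<Longrightarrow> Vector_Spaces.linear scale scale (\<rho> g)"
    and action_one: "\<rho> \<one> v = v"
    and action_mult: "g \<in> carrier G \<Longrightarrow> h \<in> carrier G \<Longrightarrow> \<rho> (g \<otimes> h) v = \<rho> g (\<rho> h v)"
    and action_rational:
      "\<phi> \<in> dual_space scale \<Longrightarrow> regular_function G n \<iota> (\<lambda>g. \<phi> (\<rho> g v))"

section \<open>Polynomial functions and their grading\<close>

text \<open>
  Over an infinite field the symmetric algebra of the dual space embeds into the functions on the
  module, so its elements and their grading are represented by functions.
\<close>

definition poly_functions :: "('k::field \<Rightarrow> 'v::ab_group_add \<Rightarrow> 'v) \<Rightarrow> ('v \<Rightarrow> 'k) set" where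
  "poly_functions scale = generated_algebra (dual_space scale)"

inductive homogeneous ::
    "('k::field \<Rightarrow> 'v::ab_group_add \<Rightarrow> 'v) \<Rightarrow> nat \<Rightarrow> ('v \<Rightarrow> 'k) \<Rightarrow> bool"
  for scale :: "'k \<Rightarrow> 'v \<Rightarrow> 'v" where
  const: "homogeneous scale 0 (\<lambda>_. c)"
| linear: "\<phi> \<in> dual_space scale \<Longrightarrow> homogeneous scale 1 \<phi>"
| add: "homogeneous scale d f \<Longrightarrow> homogeneous scale d g \<Longrightarrow> homogeneous scale d (\<lambda>v. f v + g v)"
| mult: "homogeneous scale d f \<Longrightarrow> homogeneous scale e g \<Longrightarrow>
    homogeneous scale (d + e) (\<lambda>v. f v * g v)"

definition degree_at_most ::
    "('k::field \<Rightarrow> 'v::ab_group_add \<Rightarrow> 'v) \<Rightarrow> nat \<Rightarrow> ('v \<Rightarrow> 'k) \<Rightarrow> bool" where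
  "degree_at_most scale d f \<longleftrightarrow>
     (\<exists>h. (\<forall>i\<le>d. homogeneous scale i (h i)) \<and> f = (\<lambda>v. \<Sum>i\<le>d. h i v))"

text \<open>The constant term of a polynomial function is its value at the origin.\<close>

definition plus_part :: "('v::zero \<Rightarrow> 'k::zero) set \<Rightarrow> ('v \<Rightarrow> 'k) set" where
  "plus_part S = {f \<in> S. f 0 = 0}"

section \<open>Invariants and the nullcone\<close>

text \<open>
  A subgroup \<open>H\<close> of \<open>G\<close> enters the following definitions as the group \<open>G\<lparr>carrier := H\<rparr>\<close>.
\<close>

definition fixed_points :: "('g, 'b) monoid_scheme \<Rightarrow> ('g \<Rightarrow> 'v \<Rightarrow> 'v) \<Rightarrow> 'v set" where
  "fixed_points G \<rho> = {v. \<forall>g \<in> carrier G. \<rho> g v = v}"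

definition invariants :: "('g, 'b) monoid_scheme \<Rightarrow>
    ('k::field \<Rightarrow> 'v::ab_group_add \<Rightarrow> 'v) \<Rightarrow> ('g \<Rightarrow> 'v \<Rightarrow> 'v) \<Rightarrow> ('v \<Rightarrow> 'k) set" where
  "invariants G scale \<rho> =
     {f \<in> poly_functions scale. \<forall>g \<in> carrier G. (\<lambda>v. f (\<rho> (inv\<^bsub>G\<^esub> g) v)) = f}"

definition invariants_deg :: "('g, 'b) monoid_scheme \<Rightarrow>
    ('k::field \<Rightarrow> 'v::ab_group_add \<Rightarrow> 'v) \<Rightarrow> ('g \<Rightarrow> 'v \<Rightarrow> 'v) \<Rightarrow> nat \<Rightarrow> ('v \<Rightarrow> 'k) set" where
  "invariants_deg G scale \<rho> d = {f \<in> invariants G scale \<rho>. homogeneous scale d f}"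

definition invariants_upto :: "('g, 'b) monoid_scheme \<Rightarrow>
    ('k::field \<Rightarrow> 'v::ab_group_add \<Rightarrow> 'v) \<Rightarrow> ('g \<Rightarrow> 'v \<Rightarrow> 'v) \<Rightarrow> nat \<Rightarrow> ('v \<Rightarrow> 'k) set" where
  "invariants_upto G scale \<rho> d = {f \<in> invariants G scale \<rho>. degree_at_most scale d f}"

definition nullcone :: "('g, 'b) monoid_scheme \<Rightarrow>
    ('k::field \<Rightarrow> 'v::ab_group_add \<Rightarrow> 'v) \<Rightarrow> ('g \<Rightarrow> 'v \<Rightarrow> 'v) \<Rightarrow> 'v set" where
  "nullcone G scale \<rho> = {v. \<forall>f \<in> plus_part (invariants G scale \<rho>). f v = 0}"

section \<open>The numbers \<open>\<delta>\<close>, \<open>\<sigma>\<close>, \<open>\<epsilon>\<close> and \<open>\<tau>\<close>\<close>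

definition is_delta_set :: "('g, 'b) monoid_scheme \<Rightarrow>
    ('k::field \<Rightarrow> 'v::ab_group_add \<Rightarrow> 'v) \<Rightarrow> ('g \<Rightarrow> 'v \<Rightarrow> 'v) \<Rightarrow> ('v \<Rightarrow> 'k) set \<Rightarrow> bool" where
  "is_delta_set G scale \<rho> S \<longleftrightarrow> S \<subseteq> invariants G scale \<rho> \<and>
     (\<forall>v \<in> fixed_points G \<rho> - nullcone G scale \<rho>. \<exists>f \<in> plus_part S. f v \<noteq> 0)"

definition is_sigma_set :: "('g, 'b) monoid_scheme \<Rightarrow>
    ('k::field \<Rightarrow> 'v::ab_group_add \<Rightarrow> 'v) \<Rightarrow> ('g \<Rightarrow> 'v \<Rightarrow> 'v) \<Rightarrow> ('v \<Rightarrow> 'k) set \<Rightarrow> bool" where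
  "is_sigma_set G scale \<rho> S \<longleftrightarrow> S \<subseteq> invariants G scale \<rho> \<and>
     (\<forall>v \<in> UNIV - nullcone G scale \<rho>. \<exists>f \<in> plus_part S. f v \<noteq> 0)"

text \<open>
  The infimum of a nonempty set of extended naturals is its minimum; the infimum of the empty set
  is \<open>\<infinity>\<close>. For rational modules the sets in the next two definitions are nonempty, because
  polynomial rings are noetherian.
\<close>

definition delta_number :: "('g, 'b) monoid_scheme \<Rightarrow>
    ('k::field \<Rightarrow> 'v::ab_group_add \<Rightarrow> 'v) \<Rightarrow> ('g \<Rightarrow> 'v \<Rightarrow> 'v) \<Rightarrow> enat" where
  "delta_number G scale \<rho> =
     Inf {enat d | d. is_delta_set G scale \<rho> (invariants_upto G scale \<rho> d)}"

definition sigma_number :: "('g, 'b) monoid_scheme \<Rightarrow>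
    ('k::field \<Rightarrow> 'v::ab_group_add \<Rightarrow> 'v) \<Rightarrow> ('g \<Rightarrow> 'v \<Rightarrow> 'v) \<Rightarrow> enat" where
  "sigma_number G scale \<rho> =
     Inf {enat d | d. is_sigma_set G scale \<rho> (invariants_upto G scale \<rho> d)}"

definition epsilon_at :: "('g, 'b) monoid_scheme \<Rightarrow>
    ('k::field \<Rightarrow> 'v::ab_group_add \<Rightarrow> 'v) \<Rightarrow> ('g \<Rightarrow> 'v \<Rightarrow> 'v) \<Rightarrow> 'v \<Rightarrow> enat" where
  "epsilon_at G scale \<rho> v =
     Inf {enat d | d. d > 0 \<and> (\<exists>f \<in> invariants_deg G scale \<rho> d. f v \<noteq> 0)}"

definition epsilon_number :: "('g, 'b) monoid_scheme \<Rightarrow>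
    ('k::field \<Rightarrow> 'v::ab_group_add \<Rightarrow> 'v) \<Rightarrow> ('g \<Rightarrow> 'v \<Rightarrow> 'v) \<Rightarrow> enat" where
  "epsilon_number G scale \<rho> =
     (INF v \<in> fixed_points G \<rho> - nullcone G scale \<rho>. epsilon_at G scale \<rho> v)"

definition tau_number :: "('g, 'b) monoid_scheme \<Rightarrow>
    ('k::field \<Rightarrow> 'v::ab_group_add \<Rightarrow> 'v) \<Rightarrow> ('g \<Rightarrow> 'v \<Rightarrow> 'v) \<Rightarrow> enat" where
  "tau_number G scale \<rho> = (INF v \<in> UNIV - nullcone G scale \<rho>. epsilon_at G scale \<rho> v)"

end

theory Submission
  imports Defs
begin

text \<open>
  A point outside the nullcone of \<open>G\<close> is separated from the origin by some invariant of degree at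
  most \<open>d\<close>. Since the field is infinite and \<open>G\<close> acts linearly, comparing the coefficients of
  \<open>t \<mapsto> f (t v)\<close> shows that the homogeneous components of an invariant \<open>f\<close> are invariant. One of
  these, of positive degree, does not vanish at the point, and it is also invariant under \<open>H\<close>.
\<close>

text \<open>Over a finite field the product \<open>q\<close> of all factors \<open>[:-a, 1:]\<close>
  vanishes everywhere, so \<open>q + 1\<close> has positive degree but takes only the value 1 and
  has no root.\<close>

lemma infinite_UNIV_alg_closed_field: "infinite (UNIV :: 'k::alg_closed_field set)"
proof
  assume fin: "finite (UNIV :: 'k set)"
  define q :: "'k poly" where "q = (\<Prod>a\<in>UNIV. [:-a, 1:])"
  have "degree q = card (UNIV :: 'k set)"
    unfolding q_def by (subst degree_prod_eq_sum_degree) auto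
  moreover have "card (UNIV :: 'k set) > 0"
    using fin by (simp add: card_gt_0_iff)
  ultimately have "degree (q + 1) > 0"
    by (simp add: degree_add_eq_left)
  then obtain z where "poly (q + 1) z = 0"
    using alg_closed_imp_poly_has_root by blast
  moreover have "poly q z = 0"
    using fin by (simp add: q_def poly_prod)
  ultimately show False
    by simp
qed

text \<open>The difference of the two sides is a polynomial in \<open>t\<close> with infinitely many
  roots, hence zero.\<close>

lemma power_sums_eq_imp_coeffs_eq:
  fixes a b :: "nat \<Rightarrow> 'k::idom"
  assumes inf: "infinite (UNIV :: 'k set)"
    and eq: "\<And>t. (\<Sum>i\<le>d. t ^ i * a i) = (\<Sum>i\<le>d. t ^ i * b i)"
    and "i \<le> d"
  shows "a i = b i"
proof -
  define q where "q = (\<Sum>i\<le>d. monom (a i - b i) i)"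
  have "poly q t = 0" for t
    using eq[of t] by (simp add: q_def poly_sum poly_monom algebra_simps sum_subtractf)
  then have "q = 0"
    using poly_roots_finite[of q] inf by auto
  then have "coeff q i = 0"
    by simp
  then show ?thesis
    using \<open>i \<le> d\<close> by (simp add: q_def coeff_sum)
qed

lemma homogeneous_scale:
  assumes "homogeneous scale d f"
  shows "f (scale c v) = c ^ d * f v"
  using assms
proof induction
  case (linear \<phi>)
  then show ?case
    by (simp add: dual_space_def Vector_Spaces.linear_iff)
qed (auto simp: algebra_simps power_add)

lemma homogeneous_imp_poly_functions:
  assumes "homogeneous scale d f"
  shows "f \<in> poly_functions scale"
  using assms unfolding poly_functions_def
  by induction (auto intro: generated_algebra.intros)

context rational_module
begin

lemma homogeneous_component_invariant:
  assumes inf: "infinite (UNIV :: 'k set)"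
    and f: "f \<in> invariants G scale \<rho>" "f = (\<lambda>v. \<Sum>i\<le>d. h i v)"
    and h: "\<And>i. i \<le> d \<Longrightarrow> homogeneous scale i (h i)"
    and i: "i \<le> d"
  shows "h i \<in> invariants_deg G scale \<rho> i"
proof -
  have "h i (\<rho> (inv g) v) = h i v" if g: "g \<in> carrier G" for g v
  proof -
    let ?w = "\<rho> (inv g) v"
    \<comment> \<open>By homogeneity the two sides are the values of \<open>f\<close> at
      \<open>scale t ?w\<close> and \<open>scale t v\<close>. These points lie in one orbit, since
      the action commutes with scaling.\<close>
    have "(\<Sum>i\<le>d. t ^ i * h i ?w) = (\<Sum>i\<le>d. t ^ i * h i v)" for t
    proof -
      have "(\<Sum>i\<le>d. t ^ i * h i u) = f (scale t u)" for u
        unfolding f(2) by (intro sum.cong) (auto simp: homogeneous_scale[OF h])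
      moreover have "f (scale t ?w) = f (\<rho> (inv g) (scale t v))"
        using action_linear[of "inv g"] g by (simp add: Vector_Spaces.linear_iff)
      moreover have "f (\<rho> (inv g) (scale t v)) = f (scale t v)"
        using f(1) g unfolding invariants_def by (auto dest: fun_cong)
      ultimately show ?thesis
        by simp
    qed
    from power_sums_eq_imp_coeffs_eq[OF inf this i] show ?thesis .
  qed
  then show ?thesis
    using h[OF i] by (auto simp: invariants_deg_def invariants_def homogeneous_imp_poly_functions)
qed

text \<open>A smaller group imposes fewer conditions on \<open>f\<close>, and inverses taken in
  \<open>H\<close> agree with those in \<open>G\<close>.\<close>

lemma invariants_subgroup:
  assumes "subgroup H G"
  shows "invariants G scale \<rho> \<subseteq> invariants (G\<lparr>carrier := H\<rparr>) scale \<rho>"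
  using subgroup.subset[OF assms] by (auto simp: invariants_def m_inv_consistent[OF assms])

text \<open>Having more invariants, \<open>H\<close> has a smaller common zero set.\<close>

lemma nullcone_subgroup:
  assumes "subgroup H G"
  shows "nullcone (G\<lparr>carrier := H\<rparr>) scale \<rho> \<subseteq> nullcone G scale \<rho>"
  using invariants_subgroup[OF assms] by (auto simp: nullcone_def plus_part_def)

lemma fixed_points_subgroup:
  assumes "subgroup H G"
  shows "fixed_points G \<rho> \<subseteq> fixed_points (G\<lparr>carrier := H\<rparr>) \<rho>"
  using subgroup.subset[OF assms] by (auto simp: fixed_points_def)

text \<open>This pointwise bound serves both inequalities; they differ only in the points over which
  the infimum is taken.\<close>

lemma epsilon_at_subgroup_le:
  assumes inf: "infinite (UNIV :: 'k set)"
    and H: "subgroup H G"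
    and f: "f \<in> plus_part (invariants_upto G scale \<rho> d)" "f v \<noteq> 0"
  shows "epsilon_at (G\<lparr>carrier := H\<rparr>) scale \<rho> v \<le> enat d"
proof -
  from f(1) obtain h where inv: "f \<in> invariants G scale \<rho>" and f0: "f 0 = 0"
    and h: "\<And>i. i \<le> d \<Longrightarrow> homogeneous scale i (h i)" and f_eq: "f = (\<lambda>v. \<Sum>i\<le>d. h i v)"
    by (auto simp: plus_part_def invariants_upto_def degree_at_most_def)
  \<comment> \<open>Only the component of degree 0 contributes to the value at the origin, so that
    component must vanish there.\<close>
  have "h i 0 = 0" if "i \<le> d" "i \<noteq> 0" for i
    using homogeneous_scale[OF h[OF that(1)], of 0 0] that(2) by (simp add: power_0_left)
  then have "f 0 = (\<Sum>i\<le>d. if i = 0 then h 0 0 else 0)"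
    unfolding f_eq by (intro sum.cong) auto
  then have "h 0 0 = 0"
    using f0 by simp
  \<comment> \<open>Scaling \<open>u\<close> by 0 and using \<open>0 ^ 0 = 1\<close> shows that
    \<open>h 0\<close> is constant.\<close>
  then have h0: "h 0 u = 0" for u
    using homogeneous_scale[OF h[of 0], of 0 u] by simp
  obtain i where i: "i \<le> d" "h i v \<noteq> 0"
    using f(2) unfolding f_eq by (metis atMost_iff sum.neutral)
  have "i > 0"
    using i(2) h0 by (cases i) auto
  moreover have "h i \<in> invariants_deg (G\<lparr>carrier := H\<rparr>) scale \<rho> i"
    using homogeneous_component_invariant[OF inf inv f_eq h i(1)] invariants_subgroup[OF H]
    by (auto simp: invariants_deg_def)
  ultimately have "epsilon_at (G\<lparr>carrier := H\<rparr>) scale \<rho> v \<le> enat i"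
    unfolding epsilon_at_def using i(2) by (intro Inf_lower) auto
  also have "\<dots> \<le> enat d"
    using i(1) by simp
  finally show ?thesis .
qed

lemma epsilon_number_subgroup_le_delta_number:
  assumes inf: "infinite (UNIV :: 'k set)"
    and H: "subgroup H G"
    and v: "v \<in> fixed_points G \<rho> - nullcone G scale \<rho>"
  shows "epsilon_number (G\<lparr>carrier := H\<rparr>) scale \<rho> \<le> delta_number G scale \<rho>"
  unfolding delta_number_def
proof (rule Inf_greatest, clarify)
  fix d assume "is_delta_set G scale \<rho> (invariants_upto G scale \<rho> d)"
  then obtain f where "f \<in> plus_part (invariants_upto G scale \<rho> d)" "f v \<noteq> 0"
    using v by (auto simp: is_delta_set_def)
  from epsilon_at_subgroup_le[OF inf H this]
  show "epsilon_number (G\<lparr>carrier := H\<rparr>) scale \<rho> \<le> enat d"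
    \<comment> \<open>The same \<open>v\<close> is a legitimate index for \<open>H\<close>: it is
      fixed by \<open>H\<close> and lies outside the smaller nullcone.\<close>
    unfolding epsilon_number_def
    using v fixed_points_subgroup[OF H] nullcone_subgroup[OF H] by (intro INF_lower2[of v]) auto
qed

lemma tau_number_subgroup_le_sigma_number:
  assumes inf: "infinite (UNIV :: 'k set)"
    and H: "subgroup H G"
    and v: "v \<notin> nullcone G scale \<rho>"
  shows "tau_number (G\<lparr>carrier := H\<rparr>) scale \<rho> \<le> sigma_number G scale \<rho>"
  unfolding sigma_number_def
proof (rule Inf_greatest, clarify)
  fix d assume "is_sigma_set G scale \<rho> (invariants_upto G scale \<rho> d)"
  then obtain f where "f \<in> plus_part (invariants_upto G scale \<rho> d)" "f v \<noteq> 0"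
    using v by (auto simp: is_sigma_set_def)
  from epsilon_at_subgroup_le[OF inf H this]
  show "tau_number (G\<lparr>carrier := H\<rparr>) scale \<rho> \<le> enat d"
    unfolding tau_number_def
    using v nullcone_subgroup[OF H] by (intro INF_lower2[of v]) auto
qed

end

theorem lemma3p1:
  fixes G :: "('g, 'b) monoid_scheme"
    and n :: nat and \<iota> :: "'g \<Rightarrow> 'k::alg_closed_field mat"
    and scale :: "'k \<Rightarrow> 'v::ab_group_add \<Rightarrow> 'v" and B :: "'v set"
    and \<rho> :: "'g \<Rightarrow> 'v \<Rightarrow> 'v"
    and H :: "'g set"
    and p :: nat
  assumes "CHAR('k) = p" and "p > 0"
    and "linear_algebraic_group G n \<iota>"
    and "rational_module G n \<iota> scale B \<rho>"
    and "subgroup H G"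
  shows "(fixed_points G \<rho> - nullcone G scale \<rho> \<noteq> {} \<longrightarrow>
            delta_number G scale \<rho> \<ge> epsilon_number (G\<lparr>carrier := H\<rparr>) scale \<rho>) \<and>
         (UNIV - nullcone G scale \<rho> \<noteq> {} \<longrightarrow>
            sigma_number G scale \<rho> \<ge> tau_number (G\<lparr>carrier := H\<rparr>) scale \<rho>)"
proof -
  interpret rational_module G n \<iota> scale B \<rho>
    by fact
  note inf = infinite_UNIV_alg_closed_field
  show ?thesis
    using epsilon_number_subgroup_le_delta_number[OF inf \<open>subgroup H G\<close>]
      tau_number_subgroup_le_sigma_number[OF inf \<open>subgroup H G\<close>]
    by blast
qed

end
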